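(* Let $\theta\in[0,\pi/4]$, $k\in\mathbb{N}$ with $k\ge2$, and $N\in\mathbb{N}$. If $v_N^{(k)}(\theta)<r<u_N(\theta)$ and $(C_k)$ holds for the expansion with base $\xi=re^{\mathrm{i}\theta}$, then $\xi$ has a square digit set.
   Context: $r>1$, $\mathcal{L}=\mathbb{Z}[\mathrm{i}]$, $\mathcal{X}=\{a+b\mathrm{i}:a,b\in[-1/2,1/2)\}$. For $z\in\mathcal{X}$, $d(z)$ is the unique element of $\mathcal{L}$ with $\xi z-d(z)\in\mathcal{X}$; $\mathbb{T}(z)=\xi z-d(z)$; the expansion of $z$ is $d_1d_2\cdots$ with $d_n=d(\mathbb{T}^{n-1}z)$; digit set $\mathcal{D}=\{d(z):z\in\mathcal{X}\}$. A block in $\mathcal{D}^{n}$ is admissible if it occurs as consecutive digits in the expansion of some $z\in\mathcal{X}$. $(C_k)$ means $\xi^{-k}\mathcal{X}+\sum_{j=1}^{k-1}\xi^{-j}a_j\subseteq\mathcal{X}$ for every admissible block $a_1\cdots a_{k-1}\in\mathcal{D}^{k-1}$. Square digit set: $\mathcal{D}=\{a+b\mathrm{i}:a,b\in\mathbb{Z},|a|,|b|\le M\}$ for some $M\in\mathbb{N}$. With $c=\cos\theta$, $s=\sin\theta$, $c^{(j)}=\cos(j\theta)$, $s^{(j)}=\sin(j\theta)$: $u_N(\theta)=(2N+1)/(c+s)$, and $v_N^{(k)}(\theta)$ is the unique positive root of $f_N^{(k)}(x)=x^k-2N\sum_{j=1}^{k-1}x^{k-j}(|c^{(j)}|+|s^{(j)}|)-(|c^{(k)}|+|s^{(k)}|)$.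 *)

theory Defs
  imports "HOL-Analysis.Analysis"
begin

definition gaussian_ints :: "complex set" where
  "gaussian_ints = {Complex (of_int a) (of_int b) | a b :: int. True}"

definition unit_square :: "complex set" where
  "unit_square = {Complex a b | a b :: real. a \<in> {-1/2..<1/2} \<and> b \<in> {-1/2..<1/2}}"

definition digit :: "complex \<Rightarrow> complex \<Rightarrow> complex" where
  "digit \<xi> z = (THE d. d \<in> gaussian_ints \<and> \<xi> * z - d \<in> unit_square)"

definition shift_map :: "complex \<Rightarrow> complex \<Rightarrow> complex" where
  "shift_map \<xi> z = \<xi> * z - digit \<xi> z"

text \<open>The digits of an expansion are numbered from 1; the value at index 0 is never used.\<close>

definition expansion :: "complex \<Rightarrow> complex \<Rightarrow> nat \<Rightarrow> complex" where
  "expansion \<xi> z n = digit \<xi> ((shift_map \<xi> ^^ (n - 1)) z)"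

definition digit_set :: "complex \<Rightarrow> complex set" where
  "digit_set \<xi> = digit \<xi> ` unit_square"

definition admissible :: "complex \<Rightarrow> complex list \<Rightarrow> bool" where
  "admissible \<xi> w \<longleftrightarrow> set w \<subseteq> digit_set \<xi> \<and>
     (\<exists>z\<in>unit_square. \<exists>m\<ge>1. \<forall>j<length w. w ! j = expansion \<xi> z (m + j))"

text \<open>The block \<open>a\<^sub>1 \<dots> a\<^sub>k\<^sub>-\<^sub>1\<close> is the list \<open>w\<close>, so \<open>a\<^sub>j\<close> is \<open>w ! (j - 1)\<close>.\<close>

definition condition_C :: "nat \<Rightarrow> complex \<Rightarrow> bool" where
  "condition_C k \<xi> \<longleftrightarrow>
     (\<forall>w. length w = k - 1 \<and> admissible \<xi> w \<longrightarrow>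
        (\<lambda>x. x / \<xi> ^ k + (\<Sum>j = 1..k - 1. w ! (j - 1) / \<xi> ^ j)) ` unit_square
          \<subseteq> unit_square)"

definition has_square_digit_set :: "complex \<Rightarrow> bool" where
  "has_square_digit_set \<xi> \<longleftrightarrow>
     (\<exists>M::nat. digit_set \<xi> =
        {Complex (of_int a) (of_int b) | a b :: int. \<bar>a\<bar> \<le> int M \<and> \<bar>b\<bar> \<le> int M})"

definition u_bound :: "nat \<Rightarrow> real \<Rightarrow> real" where
  "u_bound N \<theta> = (2 * real N + 1) / (cos \<theta> + sin \<theta>)"

definition f_poly :: "nat \<Rightarrow> nat \<Rightarrow> real \<Rightarrow> real \<Rightarrow> real" where
  "f_poly N k \<theta> x =
     x ^ k
     - 2 * real N * (\<Sum>j = 1..k - 1. x ^ (k - j) * (\<bar>cos (real j * \<theta>)\<bar> + \<bar>sin (real j * \<theta>)\<bar>))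
     - (\<bar>cos (real k * \<theta>)\<bar> + \<bar>sin (real k * \<theta>)\<bar>)"

definition v_bound :: "nat \<Rightarrow> nat \<Rightarrow> real \<Rightarrow> real" where
  "v_bound N k \<theta> = (THE x. x > 0 \<and> f_poly N k \<theta> x = 0)"

text \<open>Both definite descriptions above are proper.\<close>

lemma digit_ex1: "\<exists>!d. d \<in> gaussian_ints \<and> \<xi> * z - d \<in> unit_square"
proof -
  have floor_iff: "x - of_int a \<in> {-1/2..<1/2} \<longleftrightarrow> a = \<lfloor>x + 1/2\<rfloor>" for x :: real and a :: int
    by (auto simp: eq_commute[of a] floor_eq_iff)
  have sq: "w \<in> unit_square \<longleftrightarrow> Re w \<in> {-1/2..<1/2} \<and> Im w \<in> {-1/2..<1/2}" for w
    unfolding unit_square_def by (cases w) auto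
  define p where "p = \<xi> * z"
  show ?thesis
  proof (intro ex1I[of _ "Complex (of_int \<lfloor>Re p + 1/2\<rfloor>) (of_int \<lfloor>Im p + 1/2\<rfloor>)"] conjI)
    show "\<xi> * z - Complex (of_int \<lfloor>Re p + 1/2\<rfloor>) (of_int \<lfloor>Im p + 1/2\<rfloor>) \<in> unit_square"
      unfolding sq p_def[symmetric] minus_complex.sel complex.sel floor_iff by simp
  next
    fix d assume d: "d \<in> gaussian_ints \<and> \<xi> * z - d \<in> unit_square"
    then obtain a b :: int where ab: "d = Complex (of_int a) (of_int b)"
      unfolding gaussian_ints_def by auto
    from d show "d = Complex (of_int \<lfloor>Re p + 1/2\<rfloor>) (of_int \<lfloor>Im p + 1/2\<rfloor>)"
      unfolding sq p_def[symmetric] minus_complex.sel ab complex.sel floor_iff by simp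
  qed (auto simp: gaussian_ints_def)
qed

lemma f_poly_ex1:
  assumes "k \<ge> 1"
  shows "\<exists>!x. x > 0 \<and> f_poly N k \<theta> x = 0"
proof -
  define A where "A j = \<bar>cos (real j * \<theta>)\<bar> + \<bar>sin (real j * \<theta>)\<bar>" for j
  have A0: "A j \<ge> 0" for j by (simp add: A_def)
  have Apos: "A j > 0" for j
  proof -
    have "A j \<noteq> 0"
    proof
      assume "A j = 0"
      then have "cos (real j * \<theta>) = 0" "sin (real j * \<theta>) = 0"
        by (auto simp: A_def add_nonneg_eq_0_iff)
      then show False using sin_zero_norm_cos_one[of "real j * \<theta>"] by simp
    qed
    then show ?thesis using A0[of j] by simp
  qed
  define g where "g y = 2 * real N * (\<Sum>j = 1..k - 1. y ^ j * A j) + y ^ k * A k" for y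
  have fg: "f_poly N k \<theta> x = x ^ k * (1 - g (inverse x))" if "x > 0" for x
  proof -
    have "x ^ (k - j) = x ^ k * inverse x ^ j" if "j \<in> {1..k - 1}" for j
    proof -
      have "j \<le> k" using that by auto
      then show ?thesis using \<open>x > 0\<close> power_diff[of x j k] by (simp add: divide_inverse power_inverse)
    qed
    then have "(\<Sum>j = 1..k - 1. x ^ (k - j) * A j) = x ^ k * (\<Sum>j = 1..k - 1. inverse x ^ j * A j)"
      by (simp add: sum_distrib_left mult.assoc)
    moreover have "x ^ k * inverse x ^ k = 1"
      using \<open>x > 0\<close> by (simp add: power_inverse)
    ultimately show ?thesis
      unfolding f_poly_def g_def A_def[symmetric] by (simp add: algebra_simps)
  qed
  have mono: "g y < g y'" if "0 < y" "y < y'" for y y'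
    unfolding g_def
  proof (intro add_le_less_mono mult_left_mono sum_mono mult_right_mono mult_strict_right_mono)
    show "y ^ k < y' ^ k" using that assms by (intro power_strict_mono) auto
  qed (use that A0 Apos in \<open>auto intro: power_mono\<close>)
  have "\<exists>y>0. g y = 1"
  proof -
    define Y where "Y = 1 + 1 / A k"
    have Y: "Y \<ge> 1" using Apos[of k] by (simp add: Y_def)
    have "1 \<le> Y * A k" using Apos[of k] by (simp add: Y_def field_simps)
    also have "\<dots> \<le> Y ^ k * A k"
      using Y assms A0 by (intro mult_right_mono self_le_power) auto
    also have "\<dots> \<le> g Y" using Y A0 by (auto simp: g_def intro!: mult_nonneg_nonneg sum_nonneg)
    finally have "1 \<le> g Y" .
    moreover have "g 0 = 0" using assms by (auto simp: g_def power_0_left intro!: sum.neutral)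
    moreover have "continuous_on {0..Y} g" unfolding g_def by (intro continuous_intros)
    ultimately obtain y where "0 \<le> y" "g y = 1"
      using IVT'[of g 0 1 Y] Y by auto
    then show ?thesis using \<open>g 0 = 0\<close> by (intro exI[of _ y]) (auto simp: less_le)
  qed
  then obtain y where y: "y > 0" "g y = 1" by blast
  show ?thesis
  proof (intro ex1I[of _ "inverse y"])
    show "inverse y > 0 \<and> f_poly N k \<theta> (inverse y) = 0" using y by (simp add: fg)
  next
    fix x assume x: "x > 0 \<and> f_poly N k \<theta> x = 0"
    then have "g (inverse x) = 1" using fg[of x] by auto
    then have "inverse x = y"
      using mono[of "inverse x" y] mono[of y "inverse x"] x y by (cases "inverse x" y rule: linorder_cases) auto
    then show "x = inverse y" by auto
  qed
qed

end

theory Submission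
  imports Defs
begin

text \<open>
  Write \<open>c = cos \<theta>\<close> and \<open>s = sin \<theta>\<close>; the digit set is the square with \<open>M = N\<close>. Since
  \<open>r (c + s) < 2 N + 1\<close>, the rotated square \<open>\<xi> \<X>\<close> has coordinates below \<open>N + 1/2\<close> in absolute
  value, so every digit has coordinates at most \<open>N\<close>. Conversely, comparing the leading term of
  \<open>f\<^sub>N\<^sup>(\<^sup>k\<^sup>)\<close> at its root with the term \<open>j = 1\<close> gives \<open>2 N (c + s) \<le> v\<^sub>N\<^sup>(\<^sup>k\<^sup>) < r\<close>, so for every \<open>d\<close>
  with coordinates at most \<open>N\<close> the point \<open>d / \<xi>\<close> lies in \<open>\<X>\<close>, and its first digit is \<open>d\<close>.
\<close>

lemma mem_unit_square_iff:
  "w \<in> unit_square \<longleftrightarrow> Re w \<in> {-1/2..<1/2} \<and> Im w \<in> {-1/2..<1/2}"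
  unfolding unit_square_def by (cases w) auto

lemma digit_props:
  "digit \<xi> z \<in> gaussian_ints" "\<xi> * z - digit \<xi> z \<in> unit_square"
  using theI'[OF digit_ex1[of \<xi> z]] by (simp_all add: digit_def)

lemma digit_eqI:
  assumes "d \<in> gaussian_ints" "\<xi> * z - d \<in> unit_square"
  shows "digit \<xi> z = d"
  using digit_ex1[of \<xi> z] digit_props[of \<xi> z] assms by blast

lemma v_bound_props:
  assumes "k \<ge> 1"
  shows "v_bound N k \<theta> > 0" "f_poly N k \<theta> (v_bound N k \<theta>) = 0"
  using theI'[OF f_poly_ex1[OF assms, of N \<theta>]] by (simp_all add: v_bound_def)

lemma v_bound_ge:
  assumes "k \<ge> 2"
  shows "2 * real N * (\<bar>cos \<theta>\<bar> + \<bar>sin \<theta>\<bar>) \<le> v_bound N k \<theta>"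
proof -
  define v where "v = v_bound N k \<theta>"
  define A where "A j = \<bar>cos (real j * \<theta>)\<bar> + \<bar>sin (real j * \<theta>)\<bar>" for j
  have v: "v > 0" "f_poly N k \<theta> v = 0"
    using v_bound_props[of k N \<theta>] assms by (auto simp: v_def)
  \<comment> \<open>All summands are nonnegative since \<open>v > 0\<close>, and
    \<open>k \<ge> 2\<close> puts the index 1 in range.\<close>
  have "v ^ (k - 1) * A 1 \<le> (\<Sum>j = 1..k - 1. v ^ (k - j) * A j)"
    by (rule member_le_sum) (use v assms in \<open>auto simp: A_def\<close>)
  then have "2 * real N * (v ^ (k - 1) * A 1) \<le> 2 * real N * (\<Sum>j = 1..k - 1. v ^ (k - j) * A j)"
    by (rule mult_left_mono) simp
  \<comment> \<open>At the root, \<open>v ^ k\<close> exceeds the left side by exactly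
    \<open>A k \<ge> 0\<close>.\<close>
  also have "\<dots> \<le> v ^ k"
    using v(2) by (simp add: f_poly_def A_def)
  also have "\<dots> = v ^ (k - 1) * v"
    using assms by (simp add: power_eq_if)
  finally have "v ^ (k - 1) * (2 * real N * A 1) \<le> v ^ (k - 1) * v"
    by (simp add: mult_ac)
  then have "2 * real N * A 1 \<le> v"
    using v(1) by simp
  then show ?thesis by (simp add: A_def v_def)
qed

text \<open>The coordinates of \<open>\<xi> * z\<close>, and those of \<open>d / \<xi>\<close> after
  clearing \<open>(cmod \<xi>)\<^sup>2\<close>, are combinations with coefficients
  \<open>Re \<xi>\<close> and \<open>Im \<xi>\<close>; minus signs are absorbed into
  \<open>x\<close> or \<open>y\<close>.\<close>

lemma abs_lincomb_le:
  fixes x y p q m :: real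
  assumes "\<bar>x\<bar> \<le> m" "\<bar>y\<bar> \<le> m"
  shows "\<bar>p * x + q * y\<bar> \<le> m * (\<bar>p\<bar> + \<bar>q\<bar>)"
proof -
  have "\<bar>p * x + q * y\<bar> \<le> \<bar>p\<bar> * \<bar>x\<bar> + \<bar>q\<bar> * \<bar>y\<bar>"
    using abs_triangle_ineq[of "p * x" "q * y"] by (simp add: abs_mult)
  also have "\<dots> \<le> \<bar>p\<bar> * m + \<bar>q\<bar> * m"
    using assms by (intro add_mono mult_left_mono) auto
  finally show ?thesis by (simp add: algebra_simps)
qed

lemma digit_set_subset_square:
  assumes "\<bar>Re \<xi>\<bar> + \<bar>Im \<xi>\<bar> < 2 * real N + 1"
  shows "digit_set \<xi> \<subseteq>
    {Complex (of_int a) (of_int b) | a b :: int. \<bar>a\<bar> \<le> int N \<and> \<bar>b\<bar> \<le> int N}"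
proof
  fix d assume "d \<in> digit_set \<xi>"
  then obtain z where z: "z \<in> unit_square" "d = digit \<xi> z"
    unfolding digit_set_def by blast
  obtain a b :: int where ab: "d = Complex (of_int a) (of_int b)"
    using digit_props(1)[of \<xi> z] z(2) by (auto simp: gaussian_ints_def)
  \<comment> \<open>Here \<open>\<bar>n\<bar> \<le> \<bar>x\<bar> + 1/2 < N + 1\<close>, and
    \<open>n\<close> is an integer.\<close>
  have bound: "\<bar>n\<bar> \<le> int N"
    if "\<bar>x\<bar> \<le> 1/2 * (\<bar>Re \<xi>\<bar> + \<bar>Im \<xi>\<bar>)" "x - of_int n \<in> {-1/2..<1/2}" for x :: real and n :: int
  proof -
    have "\<bar>of_int n :: real\<bar> < real N + 1"
      using that assms by auto
    then have "real_of_int \<bar>n\<bar> < real_of_int (int N + 1)" by simp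
    then show ?thesis unfolding of_int_less_iff by simp
  qed
  have sq: "\<bar>Re z\<bar> \<le> 1/2" "\<bar>- Im z\<bar> \<le> 1/2" "\<bar>Im z\<bar> \<le> 1/2"
    using z(1) by (auto simp: mem_unit_square_iff)
  have "\<bar>Re (\<xi> * z)\<bar> \<le> 1/2 * (\<bar>Re \<xi>\<bar> + \<bar>Im \<xi>\<bar>)"
    using abs_lincomb_le[OF sq(1,2), of "Re \<xi>" "Im \<xi>"] by simp
  moreover have "\<bar>Im (\<xi> * z)\<bar> \<le> 1/2 * (\<bar>Re \<xi>\<bar> + \<bar>Im \<xi>\<bar>)"
    using abs_lincomb_le[OF sq(3,1), of "Re \<xi>" "Im \<xi>"] by simp
  moreover have "Re (\<xi> * z) - of_int a \<in> {-1/2..<1/2}" "Im (\<xi> * z) - of_int b \<in> {-1/2..<1/2}"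
    using digit_props(2)[of \<xi> z] unfolding z(2)[symmetric] ab mem_unit_square_iff by simp_all
  ultimately show "d \<in> {Complex (of_int a) (of_int b) | a b :: int. \<bar>a\<bar> \<le> int N \<and> \<bar>b\<bar> \<le> int N}"
    using bound ab by blast
qed

lemma square_subset_digit_set:
  assumes "\<xi> \<noteq> 0" "2 * real N * (\<bar>Re \<xi>\<bar> + \<bar>Im \<xi>\<bar>) < (cmod \<xi>)\<^sup>2"
  shows "{Complex (of_int a) (of_int b) | a b :: int. \<bar>a\<bar> \<le> int N \<and> \<bar>b\<bar> \<le> int N}
    \<subseteq> digit_set \<xi>"
proof clarify
  fix a b :: int assume "\<bar>a\<bar> \<le> int N" "\<bar>b\<bar> \<le> int N"
  then have ab: "\<bar>real_of_int a\<bar> \<le> real N" "\<bar>real_of_int b\<bar> \<le> real N" "\<bar>- real_of_int a\<bar> \<le> real N"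
    by linarith+
  define d where "d = Complex (of_int a) (of_int b)"
  \<comment> \<open>The strict hypothesis gives
    \<open>\<bar>x\<bar> < (cmod \<xi>)\<^sup>2 / 2\<close>, which avoids the excluded endpoint
    \<open>1/2\<close>.\<close>
  have in_interval: "x / (cmod \<xi>)\<^sup>2 \<in> {-1/2..<1/2}"
    if "\<bar>x\<bar> \<le> real N * (\<bar>Re \<xi>\<bar> + \<bar>Im \<xi>\<bar>)" for x
    using that assms by (auto simp: field_simps abs_le_iff)
  \<comment> \<open>Division by \<open>\<xi>\<close> is multiplication by its conjugate over
    \<open>(cmod \<xi>)\<^sup>2\<close>.\<close>
  have "Re (d / \<xi>) = (Re \<xi> * of_int a + Im \<xi> * of_int b) / (cmod \<xi>)\<^sup>2"
    by (simp add: Re_divide d_def cmod_power2 mult.commute)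
  moreover have "Im (d / \<xi>) = (Re \<xi> * of_int b + Im \<xi> * (- of_int a)) / (cmod \<xi>)\<^sup>2"
    by (simp add: Im_divide d_def cmod_power2 mult.commute)
  ultimately have "d / \<xi> \<in> unit_square"
    unfolding mem_unit_square_iff
    using in_interval[OF abs_lincomb_le[OF ab(1,2)]] in_interval[OF abs_lincomb_le[OF ab(2,3)]]
    by metis
  \<comment> \<open>The remainder \<open>\<xi> * (d / \<xi>) - d\<close> is 0, which lies in the
    square.\<close>
  moreover have "digit \<xi> (d / \<xi>) = d"
    by (rule digit_eqI) (use assms(1) in \<open>auto simp: d_def gaussian_ints_def mem_unit_square_iff\<close>)
  ultimately show "Complex (of_int a) (of_int b) \<in> digit_set \<xi>"
    unfolding digit_set_def d_def by (metis imageI)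
qed

theorem theorem3p7:
  fixes r \<theta> :: real and \<xi> :: complex and k N :: nat
  assumes "r > 1"
    and "\<theta> \<in> {0..pi / 4}"
    and "k \<ge> 2"
    and "\<xi> = complex_of_real r * exp (\<i> * complex_of_real \<theta>)"
    and "v_bound N k \<theta> < r" and "r < u_bound N \<theta>"
    and "condition_C k \<xi>"
  shows "has_square_digit_set \<xi>"
proof -
  have cs: "cos \<theta> > 0" "sin \<theta> \<ge> 0"
  proof -
    have "0 \<le> \<theta>" "\<theta> < pi / 2" "- (pi / 2) < \<theta>" "\<theta> \<le> pi"
      using assms(2) pi_gt_zero by (simp_all, linarith+)
    then show "cos \<theta> > 0" "sin \<theta> \<ge> 0"
      by (auto intro: cos_gt_zero_pi sin_ge_zero)
  qed
  have \<xi>: "\<xi> = rcis r \<theta>"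
    using assms(4) by (simp add: rcis_def cis_conv_exp)
  have norm1: "\<bar>Re \<xi>\<bar> + \<bar>Im \<xi>\<bar> = r * (cos \<theta> + sin \<theta>)"
    using cs assms(1) by (simp add: \<xi> abs_mult algebra_simps)
  have "\<bar>Re \<xi>\<bar> + \<bar>Im \<xi>\<bar> < 2 * real N + 1"
    using assms(6) cs unfolding norm1 by (simp add: u_bound_def pos_less_divide_eq)
  moreover have "2 * real N * (\<bar>Re \<xi>\<bar> + \<bar>Im \<xi>\<bar>) < (cmod \<xi>)\<^sup>2"
  proof -
    have "2 * real N * (cos \<theta> + sin \<theta>) < r"
      using v_bound_ge[OF assms(3), of N \<theta>] assms(5) cs by simp
    \<comment> \<open>Scaling by \<open>r = cmod \<xi>\<close> turns
      \<open>cos \<theta> + sin \<theta>\<close> into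
      \<open>\<bar>Re \<xi>\<bar> + \<bar>Im \<xi>\<bar>\<close>.\<close>
    then have "r * (2 * real N * (cos \<theta> + sin \<theta>)) < r * r"
      using assms(1) by simp
    then show ?thesis
      unfolding norm1 by (simp add: \<xi> power2_eq_square mult_ac)
  qed
  moreover have "\<xi> \<noteq> 0"
    using assms(1) by (simp add: \<xi>)
  ultimately show ?thesis
    unfolding has_square_digit_set_def
    using digit_set_subset_square square_subset_digit_set by blast
qed

end
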